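(* For every integer $n\geq 1$, we have $|A_{2n}(4312)|=|A_{2n}(1234)|$.
   Context: A permutation $\pi=\pi_1\pi_2\cdots\pi_m$ of $[m]=\{1,2,\ldots,m\}$ is alternating if $\pi_1<\pi_2>\pi_3<\pi_4>\cdots$. A permutation $\pi$ contains a pattern $\sigma=\sigma_1\cdots\sigma_k\in S_k$ if there are indices $i_1<i_2<\cdots<i_k$ such that $\pi_{i_1}\pi_{i_2}\cdots\pi_{i_k}$ is order isomorphic to $\sigma$, i.e. $\pi_{i_l}<\pi_{i_r}$ if and only if $\sigma_l<\sigma_r$ for all $l,r\in[k]$; otherwise $\pi$ avoids $\sigma$. $A_m(\sigma)$ denotes the set of alternating permutations of $[m]$ that avoid $\sigma$. *)

theory Defs
  imports "HOL-Combinatorics.Multiset_Permutations"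
begin

text \<open>
  A permutation of $[m]$ is given in one-line notation, as an element of
  \<open>permutations_of_set {1..m}\<close>. List positions start at 0, so the entry
  $\pi_i$ is \<open>p ! (i - 1)\<close>.
\<close>

text \<open>$\pi_1 < \pi_2 > \pi_3 < \cdots$: with positions starting at 0, ascents are at the even ones.\<close>

definition alternating :: "nat list \<Rightarrow> bool" where
  "alternating p \<longleftrightarrow>
     (\<forall>i. Suc i < length p \<longrightarrow>
        (if even i then p ! i < p ! Suc i else p ! i > p ! Suc i))"

definition contains_pattern :: "nat list \<Rightarrow> nat list \<Rightarrow> bool" where
  "contains_pattern p s \<longleftrightarrow>
     (\<exists>f :: nat \<Rightarrow> nat.
        strict_mono_on {..<length s} f \<and>
        f ` {..<length s} \<subseteq> {..<length p} \<and>
        (\<forall>l<length s. \<forall>r<length s. p ! f l < p ! f r \<longleftrightarrow> s ! l < s ! r))"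

definition avoids :: "nat list \<Rightarrow> nat list \<Rightarrow> bool" where
  "avoids p s \<longleftrightarrow> \<not> contains_pattern p s"

definition alternating_avoiding :: "nat \<Rightarrow> nat list \<Rightarrow> nat list set" where
  "alternating_avoiding m s =
     {p \<in> permutations_of_set {1..m}. alternating p \<and> avoids p s}"

end

theory Submission
  imports Defs "HOL-Library.Sublist"
begin

text \<open>
  Every alternating permutation of length $2n+2$ arises in exactly one way by putting two letters
  in front of an alternating permutation $\pi$ of $[m]$, $m = 2n$, and shifting the entries of
  $\pi$ to make room: for $j \le k \le m$ the new letters are $j+1$ and $k+2$, so that $j$ and $k$
  count the entries of $\pi$ below each of them. Thus both families are generating trees, and it is
  enough to record at each node labels that determine the labels of the children.

  For 1234 the labels $a \le b$ of $\pi$ are the greatest numbers such that its $a$ largest entries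
  avoid 12 and its $b$ largest entries avoid 123. The labels of the children turn out to be all $(x,y)$ with
  $1 \le x \le a+1$, $x+1 \le y \le b+2$, each once
  (\<open>sum_step_1234\<close>, \<open>grow_high_eq_grow_1234\<close>).

  For 4312 the labels $d \le e$ are the greatest numbers such that the $d$ smallest entries avoid 12
  and the $e$ smallest entries avoid 312. A new front letter can only play the 4 of an occurrence of 4312, so the second new letter may have at
  most $e$ entries below it and there is no other condition; to alternate, it must also exceed
  the first letter $f$ of $\pi$. There are two kinds of children. If the new first letter is at most
  $d+1$, the child has $f = d$ again and continues the tree; these fertile children have the labels
  $(w,y)$ with $1 \le w \le d+1$, $d+2 \le y \le e+2$. Otherwise the child has $f = e + 1$,
  which leaves no room for further letters; there are $e+1-b$ such barren children
  with labels $(d,b)$, for each $b$ with $d < b \le e$ (\<open>grow_4312_diagonal\<close>).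

  The two trees are not isomorphic, since only one of them has leaves. But let $K$, $H$, $V$ be the
  operators that take a function $\Phi$ of the labels to its sum over, respectively, the 1234-children,
  the fertile 4312-children and the barren 4312-children of a node. Then $H(H+V) = (H+V)K$
  (\<open>fertile_barren_intertwine\<close>), an identity between finite sums. A node of level $n+1$ of the
  4312-tree is reached by $n$ fertile steps and one arbitrary step, so the sum of $\Phi$ over that level
  is $H^n(H+V)\Phi = (H+V)K^n\Phi$ evaluated at the labels $(0,0)$ of the empty permutation, where
  $H+V$ and $K$ agree. This is the sum of $\Phi$ over level $n+1$ of the 1234-tree. Hence $(d,e)$ on
  $A_{2n}(4312)$ and $(a,b)$ on $A_{2n}(1234)$ even have the same joint distribution
  (\<open>labels_equidistributed\<close>); $\Phi = 1$ counts the permutations.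
\<close>

section \<open>Pattern containment and the first entry of a list\<close>

text \<open>
  Subsequences in place of index maps make occurrences of a pattern accessible to recursion on the list.
\<close>

definition order_iso :: "nat list \<Rightarrow> nat list \<Rightarrow> bool" where
  "order_iso q s \<longleftrightarrow> length q = length s \<and>
     (\<forall>l<length s. \<forall>r<length s. q ! l < q ! r \<longleftrightarrow> s ! l < s ! r)"

lemma subseq_map_nth:
  assumes "sorted_wrt (<) is" "set is \<subseteq> {..<length p}"
  shows "subseq (map ((!) p) is) p"
  using assms
proof (induction p arbitrary: "is")
  case Nil
  then show ?case by simp
next
  case (Cons x p)
  have shift: "subseq (map ((!) (x # p)) ks) p"
    if "sorted_wrt (<) ks" "\<forall>k\<in>set ks. 0 < k \<and> k < Suc (length p)" for ks
  proof -
    have "map ((!) (x # p)) ks = map ((!) p) (map (\<lambda>k. k - 1) ks)"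
      using that(2) by auto
    moreover have "sorted_wrt (<) (map (\<lambda>k. k - 1) ks)"
      unfolding sorted_wrt_map
      by (rule sorted_wrt_mono_rel[OF _ that(1)]) (use that(2) in force)
    moreover have "set (map (\<lambda>k. k - 1) ks) \<subseteq> {..<length p}"
      using that(2) by force
    ultimately show ?thesis using Cons.IH by metis
  qed
  show ?case
  proof (cases "is")
    case Nil
    then show ?thesis by simp
  next
    case (Cons i ks)
    show ?thesis
    proof (cases "i = 0")
      case True
      have "subseq (map ((!) (x # p)) ks) p"
        by (rule shift) (use Cons.prems \<open>is = i # ks\<close> True in auto)
      then show ?thesis using \<open>is = i # ks\<close> True by simp
    next
      case False
      have "subseq (map ((!) (x # p)) is) p"
        by (rule shift) (use Cons.prems \<open>is = i # ks\<close> False in auto)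
      then show ?thesis by (simp add: list_emb_Cons)
    qed
  qed
qed

lemma subseq_embedding:
  assumes "subseq q p"
  shows "\<exists>f. strict_mono_on {..<length q} f \<and> f ` {..<length q} \<subseteq> {..<length p} \<and>
             (\<forall>l<length q. q ! l = p ! f l)"
  using assms
proof (induction rule: list_emb.induct)
  case (list_emb_Nil ys)
  then show ?case by (auto simp: strict_mono_on_def)
next
  case (list_emb_Cons xs ys y)
  then obtain f where "strict_mono_on {..<length xs} f" "f ` {..<length xs} \<subseteq> {..<length ys}"
    "\<forall>l<length xs. xs ! l = ys ! f l" by blast
  then show ?case
    by (intro exI[of _ "\<lambda>l. Suc (f l)"]) (auto simp: strict_mono_on_def)
next
  case (list_emb_Cons2 x y xs ys)
  then obtain f where f: "strict_mono_on {..<length xs} f" "f ` {..<length xs} \<subseteq> {..<length ys}"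
    "\<forall>l<length xs. xs ! l = ys ! f l" by blast
  show ?case
  proof (intro exI[of _ "\<lambda>l. case l of 0 \<Rightarrow> 0 | Suc l \<Rightarrow> Suc (f l)"] conjI)
    show "strict_mono_on {..<length (x # xs)} (\<lambda>l. case l of 0 \<Rightarrow> 0 | Suc l \<Rightarrow> Suc (f l))"
      using f(1) by (auto simp: strict_mono_on_def split: nat.splits)
    show "(\<lambda>l. case l of 0 \<Rightarrow> 0 | Suc l \<Rightarrow> Suc (f l)) ` {..<length (x # xs)} \<subseteq> {..<length (y # ys)}"
      using f(2) by (auto simp: image_subset_iff split: nat.splits)
    show "\<forall>l<length (x # xs). (x # xs) ! l = (y # ys) ! (case l of 0 \<Rightarrow> 0 | Suc l \<Rightarrow> Suc (f l))"
      using f(3) list_emb_Cons2 by (auto split: nat.splits)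
  qed
qed

lemma contains_pattern_iff_subseq:
  "contains_pattern p s \<longleftrightarrow> (\<exists>q. subseq q p \<and> order_iso q s)"
proof
  assume "contains_pattern p s"
  then obtain f where f: "strict_mono_on {..<length s} f" "f ` {..<length s} \<subseteq> {..<length p}"
    "\<forall>l<length s. \<forall>r<length s. p ! f l < p ! f r \<longleftrightarrow> s ! l < s ! r"
    unfolding contains_pattern_def by blast
  let ?q = "map ((!) p) (map f [0..<length s])"
  have "sorted_wrt (<) (map f [0..<length s])"
    using f(1) by (auto simp: sorted_wrt_iff_nth_less strict_mono_on_def)
  then have "subseq ?q p"
    by (rule subseq_map_nth) (use f(2) in \<open>auto simp: image_subset_iff\<close>)
  moreover have "order_iso ?q s"
    using f(3) by (auto simp: order_iso_def)
  ultimately show "\<exists>q. subseq q p \<and> order_iso q s" by blast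
next
  assume "\<exists>q. subseq q p \<and> order_iso q s"
  then obtain q where q: "subseq q p" "order_iso q s" by blast
  have len: "length q = length s" using q(2) by (simp add: order_iso_def)
  obtain f where "strict_mono_on {..<length s} f" "f ` {..<length s} \<subseteq> {..<length p}"
    "\<forall>l<length s. q ! l = p ! f l"
    using subseq_embedding[OF q(1)] len by auto
  then show "contains_pattern p s"
    using q(2) unfolding contains_pattern_def order_iso_def by (intro exI[of _ f]) simp
qed

lemma subseq_Cons_iff:
  "subseq q (x # xs) \<longleftrightarrow> subseq q xs \<or> (\<exists>q'. q = x # q' \<and> subseq q' xs)"
proof (cases q)
  case (Cons y q')
  then show ?thesis using subseq_Cons'[of y q' xs] by auto
qed simp

lemma subseq_filter_iff: "subseq q (filter P xs) \<longleftrightarrow> subseq q xs \<and> (\<forall>y\<in>set q. P y)"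
proof (induction xs arbitrary: q)
  case Nil
  then show ?case by (cases q) simp_all
next
  case (Cons x xs)
  then show ?case by (cases "P x") (auto simp only: filter.simps if_True if_False subseq_Cons_iff list.set ball_simps)
qed

lemma order_iso_Cons_max:
  assumes "\<forall>y\<in>set s. y < c"
  shows "order_iso (x # q) (c # s) \<longleftrightarrow> order_iso q s \<and> (\<forall>y\<in>set q. y < x)"
proof (cases "length q = length s")
  case True
  have c: "s ! l < c" "\<not> c < s ! l" if "l < length s" for l
    using assms nth_mem[OF that] by (auto simp: less_not_sym)
  have "order_iso (x # q) (c # s) \<longleftrightarrow> order_iso q s \<and> (\<forall>l<length s. q ! l < x \<and> \<not> x < q ! l)"
    unfolding order_iso_def using True by (simp add: All_less_Suc2 c) blast
  then show ?thesis using True by (simp add: all_set_conv_all_nth) (use less_not_sym in blast)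
qed (simp add: order_iso_def)

lemma order_iso_Cons_min:
  assumes "\<forall>y\<in>set s. c < y"
  shows "order_iso (x # q) (c # s) \<longleftrightarrow> order_iso q s \<and> (\<forall>y\<in>set q. x < y)"
proof (cases "length q = length s")
  case True
  have c: "c < s ! l" "\<not> s ! l < c" if "l < length s" for l
    using assms nth_mem[OF that] by (auto simp: less_not_sym)
  have "order_iso (x # q) (c # s) \<longleftrightarrow> order_iso q s \<and> (\<forall>l<length s. x < q ! l \<and> \<not> q ! l < x)"
    unfolding order_iso_def using True by (simp add: All_less_Suc2 c) blast
  then show ?thesis using True by (simp add: all_set_conv_all_nth) (use less_not_sym in blast)
qed (simp add: order_iso_def)

lemma contains_pattern_Cons:
  "contains_pattern (x # xs) s \<longleftrightarrow>
     contains_pattern xs s \<or> (\<exists>q. subseq q xs \<and> order_iso (x # q) s)"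
  unfolding contains_pattern_iff_subseq subseq_Cons_iff by blast

text \<open>
  If the first letter of the pattern is its maximum, an occurrence that uses the first entry \<open>x\<close>
  is an occurrence of the remaining pattern among the entries below \<open>x\<close>. With the dual
  statement for minima, this reduces every avoidance condition below to shorter patterns.
\<close>

lemma avoids_Cons_max:
  assumes "\<forall>y\<in>set s. y < c"
  shows "avoids (x # xs) (c # s) \<longleftrightarrow> avoids xs (c # s) \<and> avoids (filter (\<lambda>y. y < x) xs) s"
  unfolding avoids_def contains_pattern_Cons order_iso_Cons_max[OF assms]
    contains_pattern_iff_subseq[of "filter _ _"] subseq_filter_iff
  by (simp only: de_Morgan_disj conj_ac)

lemma avoids_Cons_min:
  assumes "\<forall>y\<in>set s. c < y"
  shows "avoids (x # xs) (c # s) \<longleftrightarrow> avoids xs (c # s) \<and> avoids (filter (\<lambda>y. x < y) xs) s"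
  unfolding avoids_def contains_pattern_Cons order_iso_Cons_min[OF assms]
    contains_pattern_iff_subseq[of "filter _ _"] subseq_filter_iff
  by (simp only: de_Morgan_disj conj_ac)

lemma avoids_Nil [simp]: "avoids [] (c # s)"
  by (simp add: avoids_def contains_pattern_def lessThan_Suc)

lemma avoids_singleton [simp]: "avoids xs [c] \<longleftrightarrow> xs = []"
proof (cases xs)
  case (Cons x ys)
  have "\<not> avoids zs []" for zs
    by (simp add: avoids_def contains_pattern_def)
  then show ?thesis using Cons avoids_Cons_max[of "[]" c x ys] by simp
qed simp

lemma avoids_filter: "avoids xs s \<Longrightarrow> avoids (filter P xs) s"
  unfolding avoids_def contains_pattern_iff_subseq subseq_filter_iff by metis

lemma avoids_map:
  assumes "strict_mono (g :: nat \<Rightarrow> nat)"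
  shows "avoids (map g xs) s \<longleftrightarrow> avoids xs s"
proof -
  have "(\<forall>l<length s. \<forall>r<length s. map g xs ! f l < map g xs ! f r \<longleftrightarrow> s ! l < s ! r) \<longleftrightarrow>
        (\<forall>l<length s. \<forall>r<length s. xs ! f l < xs ! f r \<longleftrightarrow> s ! l < s ! r)"
    if "f ` {..<length s} \<subseteq> {..<length xs}" for f
  proof -
    have "map g xs ! f l = g (xs ! f l)" if "l < length s" for l
      using that \<open>f ` {..<length s} \<subseteq> {..<length xs}\<close> by (auto simp: image_subset_iff)
    then show ?thesis using strict_mono_less[OF assms] by auto
  qed
  then show ?thesis unfolding avoids_def contains_pattern_def
    by (metis (no_types, lifting) length_map)
qed

lemma alternating_map:
  assumes "strict_mono (g :: nat \<Rightarrow> nat)"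
  shows "alternating (map g xs) \<longleftrightarrow> alternating xs"
  using strict_mono_less[OF assms] by (auto simp: alternating_def)

lemma alternating_Nil [simp]: "alternating []"
  by (simp add: alternating_def)

lemma alternating_Cons_Cons:
  "alternating (x # y # xs) \<longleftrightarrow> x < y \<and> (xs \<noteq> [] \<longrightarrow> hd xs < y) \<and> alternating xs"
proof -
  have all_Suc: "(\<forall>i. P i) \<longleftrightarrow> P 0 \<and> (\<forall>i. P (Suc i))" for P
  proof (intro iffI conjI allI)
    fix i assume "P 0 \<and> (\<forall>i. P (Suc i))"
    then show "P i" by (cases i) simp_all
  qed simp_all
  define Q where "Q i \<longleftrightarrow> (Suc i < length (x # y # xs) \<longrightarrow>
     (if even i then (x # y # xs) ! i < (x # y # xs) ! Suc i
      else (x # y # xs) ! i > (x # y # xs) ! Suc i))" for i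
  have "alternating (x # y # xs) \<longleftrightarrow> Q 0 \<and> Q (Suc 0) \<and> (\<forall>i. Q (Suc (Suc i)))"
    using all_Suc[of Q] all_Suc[of "\<lambda>i. Q (Suc i)"] by (simp add: alternating_def Q_def)
  also have "\<dots> \<longleftrightarrow> x < y \<and> (xs \<noteq> [] \<longrightarrow> xs ! 0 < y) \<and> alternating xs"
    by (auto simp: Q_def alternating_def)
  finally show ?thesis by (cases xs) simp_all
qed

section \<open>Prepending two letters to an alternating permutation\<close>

text \<open>
  For $j \le k \le m$ this is the increasing bijection from $[m]$ onto $[m+2] \setminus \{j+1, k+2\}$.
\<close>

definition shift :: "nat \<Rightarrow> nat \<Rightarrow> nat \<Rightarrow> nat" where
  "shift j k v = (if v \<le> j then v else if v \<le> k then v + 1 else v + 2)"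

definition prepend :: "nat \<Rightarrow> nat \<Rightarrow> nat list \<Rightarrow> nat list" where
  "prepend j k p = (j + 1) # (k + 2) # map (shift j k) p"

text \<open>
  The right adjoint of \<open>shift j k\<close>; on the values that \<open>shift j k\<close> takes it is the inverse.
\<close>

definition unshift :: "nat \<Rightarrow> nat \<Rightarrow> nat \<Rightarrow> nat" where
  "unshift j k t = (if t \<le> j then t else if t \<le> k + 1 then t - 1 else t - 2)"

lemma strict_mono_shift: "j \<le> k \<Longrightarrow> strict_mono (shift j k)"
  by (auto simp: strict_mono_def shift_def)

lemma shift_le_iff: "j \<le> k \<Longrightarrow> shift j k v \<le> t \<longleftrightarrow> v \<le> unshift j k t"
  by (auto simp: shift_def unshift_def)

lemma shift_image:
  assumes "j \<le> k" "k \<le> m"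
  shows "shift j k ` {1..m} = {1..m+2} - {j+1, k+2}"
proof
  show "shift j k ` {1..m} \<subseteq> {1..m+2} - {j+1, k+2}"
    using assms by (auto simp: shift_def)
  show "{1..m+2} - {j+1, k+2} \<subseteq> shift j k ` {1..m}"
  proof
    fix v assume v: "v \<in> {1..m+2} - {j+1, k+2}"
    then have "v = shift j k (unshift j k v)" "unshift j k v \<in> {1..m}"
      using assms by (auto simp: shift_def unshift_def)
    then show "v \<in> shift j k ` {1..m}" by blast
  qed
qed

lemma prepend_inj:
  assumes "j \<le> k" "j' \<le> k'" "prepend j k p = prepend j' k' p'"
  shows "j = j' \<and> k = k' \<and> p = p'"
proof -
  have "inj (shift j k)" using strict_mono_imp_inj_on[OF strict_mono_shift[OF assms(1)]] .
  moreover have "j = j' \<and> k = k' \<and> map (shift j k) p = map (shift j k) p'"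
    using assms(3) by (auto simp: prepend_def)
  ultimately show ?thesis by (metis inj_map_eq_map)
qed

lemma prepend_in_permutations:
  assumes p: "p \<in> permutations_of_set {1..m}" and jk: "j \<le> k" "k \<le> m"
  shows "prepend j k p \<in> permutations_of_set {1..m+2}"
proof -
  have "inj_on (shift j k) (set p)"
    using strict_mono_imp_inj_on[OF strict_mono_shift[OF jk(1)]] inj_on_subset by blast
  then have "distinct (map (shift j k) p)"
    using p by (simp add: permutations_of_set_def distinct_map)
  moreover have "set (map (shift j k) p) = {1..m+2} - {j+1, k+2}"
    using p shift_image[OF jk] by (simp add: permutations_of_set_def)
  moreover have "insert (j+1) (insert (k+2) ({1..m+2} - {j+1, k+2})) = {1..m+2}"
    using jk by auto
  ultimately show ?thesis
    using jk unfolding permutations_of_set_def prepend_def by (simp del: set_map)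
qed

lemma permutation_eq_prepend:
  assumes r: "r \<in> permutations_of_set {1..m+2}" "r ! 0 < r ! 1"
  obtains p j k where "p \<in> permutations_of_set {1..m}" "j \<le> k" "k \<le> m" "r = prepend j k p"
proof -
  have set_r: "set r = {1..m+2}" and dist_r: "distinct r"
    using r by (simp_all add: permutations_of_set_def)
  then have "length r = m + 2" using distinct_card[of r] by simp
  then obtain x y q where xyq: "r = x # y # q"
    by (auto simp: length_Suc_conv)
  define j k p where "j = x - 1" "k = y - 2" "p = map (unshift j k) q"
  have "x \<in> set r" "y \<in> set r" using xyq by simp_all
  then have "1 \<le> x" "y \<le> m + 2" unfolding set_r by simp_all
  moreover have "x < y" using r(2) xyq by simp
  ultimately have jk: "j \<le> k" "k \<le> m" "x = j + 1" "y = k + 2" by (auto simp: j_k_p_def)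
  have "set q = set r - {x, y}"
    using dist_r xyq by auto
  then have q: "set q = {1..m+2} - {j+1, k+2}"
    unfolding set_r jk(3,4) .
  have shift_p: "map (shift j k) p = q"
    unfolding j_k_p_def(3) map_map
  proof (rule map_idI)
    fix v assume "v \<in> set q"
    then have "v \<noteq> j + 1" "v \<noteq> k + 2" unfolding q by simp_all
    then show "(shift j k \<circ> unshift j k) v = v" using jk(1) by (auto simp: shift_def unshift_def)
  qed
  then have rp: "r = prepend j k p" using xyq jk by (simp add: prepend_def)
  have inj: "inj (shift j k)"
    using strict_mono_imp_inj_on[OF strict_mono_shift[OF jk(1)]] .
  have "shift j k ` set p = shift j k ` {1..m}"
    unfolding shift_image[OF jk(1,2)] q[symmetric] shift_p[symmetric] by (rule set_map[symmetric])
  then have "set p = {1..m}" by (simp only: inj_image_eq_iff[OF inj])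
  moreover have "distinct (map (shift j k) p)" unfolding shift_p using dist_r xyq by simp
  then have "distinct p" by (simp add: distinct_map)
  ultimately have "p \<in> permutations_of_set {1..m}" by (simp add: permutations_of_set_def)
  then show thesis using that jk rp by blast
qed

lemma permutation_length: "p \<in> permutations_of_set {1..m} \<Longrightarrow> length p = m"
  using length_finite_permutations_of_set[of p "{1..m}"] by simp

text \<open>
  The generating tree in the form in which it is used: a sum over one level is a sum over the
  children of the previous level. The condition on \<open>hd p\<close> is the descent from the second new
  letter to the shifted first letter of \<open>p\<close>; the predicate \<open>ok\<close> is what avoidance of the pattern
  demands of the new letters.
\<close>

lemma sum_alternating_avoiding_prepend:
  assumes children: "\<And>p j k. p \<in> permutations_of_set {1..m} \<Longrightarrow> j \<le> k \<Longrightarrow> k \<le> m \<Longrightarrow>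
      alternating p \<Longrightarrow> (p \<noteq> [] \<Longrightarrow> hd p \<le> k) \<Longrightarrow>
      avoids (prepend j k p) s \<longleftrightarrow> avoids p s \<and> ok p k j"
  shows "(\<Sum>r\<in>alternating_avoiding (m + 2) s. F r) =
     (\<Sum>p\<in>alternating_avoiding m s. \<Sum>k | k \<le> m \<and> (p \<noteq> [] \<longrightarrow> hd p \<le> k). \<Sum>j | j \<le> k \<and> ok p k j. F (prepend j k p))"
proof -
  define I where "I = (SIGMA p:alternating_avoiding m s.
     SIGMA k:{k. k \<le> m \<and> (p \<noteq> [] \<longrightarrow> hd p \<le> k)}. {j. j \<le> k \<and> ok p k j})"
  have alt: "alternating (prepend j k p) \<longleftrightarrow> (p \<noteq> [] \<longrightarrow> hd p \<le> k) \<and> alternating p" if "j \<le> k" for j k p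
  proof -
    have "shift j k v < k + 2 \<longleftrightarrow> v \<le> k" for v using that by (simp add: shift_def)
    then show ?thesis using that strict_mono_shift[OF that]
      by (simp add: prepend_def alternating_Cons_Cons alternating_map hd_map cong: conj_cong)
  qed
  have fin: "finite (alternating_avoiding m s)" by (simp add: alternating_avoiding_def)
  have bij: "bij_betw (\<lambda>(p,k,j). prepend j k p) I (alternating_avoiding (m + 2) s)"
      unfolding bij_betw_def
    proof
      show "inj_on (\<lambda>(p,k,j). prepend j k p) I"
      proof (rule inj_onI)
        fix x y assume *: "x \<in> I" "y \<in> I"
          "(case x of (p,k,j) \<Rightarrow> prepend j k p) = (case y of (p,k,j) \<Rightarrow> prepend j k p)"
        obtain p k j p' k' j' where "x = (p, k, j)" "y = (p', k', j')"
          by (cases x, cases y) auto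
        then show "x = y" using * prepend_inj[of j k j' k' p p'] by (simp add: I_def)
      qed
      show "(\<lambda>(p,k,j). prepend j k p) ` I = alternating_avoiding (m + 2) s"
      proof safe
        fix p k j assume *: "(p, k, j) \<in> I"
        then have p: "p \<in> permutations_of_set {1..m}" "alternating p" "avoids p s" "j \<le> k" "k \<le> m"
          "p \<noteq> [] \<longrightarrow> hd p \<le> k" "ok p k j"
          by (simp_all add: I_def alternating_avoiding_def)
        then show "prepend j k p \<in> alternating_avoiding (m + 2) s"
          using children[of p j k] alt[of j k p] prepend_in_permutations[of p m j k]
          by (simp add: alternating_avoiding_def)
      next
        fix r assume "r \<in> alternating_avoiding (m + 2) s"
        then have r: "r \<in> permutations_of_set {1..m+2}" "alternating r" "avoids r s"
          by (simp_all add: alternating_avoiding_def)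
        have "r ! 0 < r ! 1"
          using r(2) permutation_length[OF r(1)] by (auto simp: alternating_def)
        with r(1) obtain p j k where *: "p \<in> permutations_of_set {1..m}" "j \<le> k" "k \<le> m" "r = prepend j k p"
          by (rule permutation_eq_prepend)
        then have "(p, k, j) \<in> I"
          using r children[of p j k] alt[of j k p] by (simp add: I_def alternating_avoiding_def)
        then show "r \<in> (\<lambda>(p,k,j). prepend j k p) ` I" using *(4) by force
      qed
    qed
  have "(\<Sum>r\<in>alternating_avoiding (m + 2) s. F r) = (\<Sum>(p,k,j)\<in>I. F (prepend j k p))"
    using sum.reindex_bij_betw[OF bij, of F] by (simp add: case_prod_beta)
  also have "\<dots> = (\<Sum>p\<in>alternating_avoiding m s.
      \<Sum>(k,j)\<in>(SIGMA k:{k. k \<le> m \<and> (p \<noteq> [] \<longrightarrow> hd p \<le> k)}. {j. j \<le> k \<and> ok p k j}). F (prepend j k p))"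
    unfolding I_def by (subst sum.Sigma[symmetric]) (auto simp: fin case_prod_beta)
  also have "\<dots> = (\<Sum>p\<in>alternating_avoiding m s. \<Sum>k | k \<le> m \<and> (p \<noteq> [] \<longrightarrow> hd p \<le> k).
      \<Sum>j | j \<le> k \<and> ok p k j. F (prepend j k p))"
    by (intro sum.cong[OF refl], subst sum.Sigma) auto
  finally show ?thesis .
qed

section \<open>Labels of a permutation\<close>

text \<open>
  The labels of the introduction: $d$ and $e$ are low labels of the patterns 12 and 312, while $a$ and
  $b$ are high labels of 12 and 123. The latter patterns appear as 34 and 234, the forms in which they
  arise as final segments of 1234.
\<close>

definition low_label :: "nat list \<Rightarrow> nat list \<Rightarrow> nat" where
  "low_label s p = Max {t. t \<le> length p \<and> avoids (filter (\<lambda>v. v \<le> t) p) s}"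

definition high_label :: "nat list \<Rightarrow> nat list \<Rightarrow> nat" where
  "high_label s p = Max {t. t \<le> length p \<and> avoids (filter (\<lambda>v. length p - t < v) p) s}"

lemma Max_threshold:
  fixes m :: nat
  assumes "Q 0" "\<And>t t'. t \<le> t' \<Longrightarrow> Q t' \<Longrightarrow> Q t" "t \<le> m"
  shows "t \<le> Max {t. t \<le> m \<and> Q t} \<longleftrightarrow> Q t"
proof -
  let ?T = "{t. t \<le> m \<and> Q t}"
  have T: "finite ?T" "?T \<noteq> {}" using assms(1) by auto
  show ?thesis
  proof
    assume "t \<le> Max ?T"
    then show "Q t" using assms(2) Max_in[OF T] by blast
  next
    assume "Q t"
    then show "t \<le> Max ?T" using Max_ge[OF T(1)] assms(3) by simp
  qed
qed

lemma filter_filter_le: "a \<le> b \<Longrightarrow> filter (\<lambda>v. v \<le> a) (filter (\<lambda>v. v \<le> (b::nat)) xs) = filter (\<lambda>v. v \<le> a) xs"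
  unfolding filter_filter by (rule filter_cong[OF refl]) linarith

lemma filter_filter_greater: "b \<le> a \<Longrightarrow> filter (\<lambda>v. a < v) (filter (\<lambda>v. (b::nat) < v) xs) = filter (\<lambda>v. a < v) xs"
  unfolding filter_filter by (rule filter_cong[OF refl]) linarith

lemma avoids_filter_le_mono:
  "a \<le> b \<Longrightarrow> avoids (filter (\<lambda>v. v \<le> b) xs) s \<Longrightarrow> avoids (filter (\<lambda>v. v \<le> a) xs) s"
  using avoids_filter[of "filter (\<lambda>v. v \<le> b) xs" s "\<lambda>v. v \<le> a"] by (simp only: filter_filter_le)

lemma avoids_filter_greater_mono:
  "b \<le> a \<Longrightarrow> avoids (filter (\<lambda>v. b < v) xs) s \<Longrightarrow> avoids (filter (\<lambda>v. a < v) xs) s"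
  using avoids_filter[of "filter (\<lambda>v. b < v) xs" s "\<lambda>v. a < v"] by (simp only: filter_filter_greater)

text \<open>
  The labels are thresholds: avoidance passes to smaller sets of entries, so all avoidance
  statements about initial or final value ranges can be read off from them.
\<close>

lemma le_low_label_iff:
  assumes "p \<in> permutations_of_set {1..m}" "t \<le> m"
  shows "t \<le> low_label (c # s) p \<longleftrightarrow> avoids (filter (\<lambda>v. v \<le> t) p) (c # s)"
proof -
  have "filter (\<lambda>v. v \<le> 0) p = []"
    using assms(1) by (auto simp: permutations_of_set_def filter_empty_conv)
  then have "avoids (filter (\<lambda>v. v \<le> 0) p) (c # s)" by (simp only: avoids_Nil)
  then show ?thesis
    unfolding low_label_def permutation_length[OF assms(1)]
    using avoids_filter_le_mono assms(2) by (intro Max_threshold)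
qed

lemma le_high_label_iff:
  assumes "p \<in> permutations_of_set {1..m}" "u \<le> m"
  shows "m \<le> high_label (c # s) p + u \<longleftrightarrow> avoids (filter (\<lambda>v. u < v) p) (c # s)"
proof -
  have "filter (\<lambda>v. m - 0 < v) p = []"
    using assms(1) by (auto simp: permutations_of_set_def filter_empty_conv)
  then have "avoids (filter (\<lambda>v. m - 0 < v) p) (c # s)" by (simp only: avoids_Nil)
  moreover have "avoids (filter (\<lambda>v. m - t < v) p) (c # s)"
    if "t \<le> t'" "avoids (filter (\<lambda>v. m - t' < v) p) (c # s)" for t t'
    using avoids_filter_greater_mono[OF diff_le_mono2[OF that(1)] that(2)] .
  ultimately have "m - u \<le> high_label (c # s) p \<longleftrightarrow> avoids (filter (\<lambda>v. m - (m - u) < v) p) (c # s)"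
    unfolding high_label_def permutation_length[OF assms(1)]
    by (intro Max_threshold) auto
  then show ?thesis using assms(2) by (simp add: le_diff_conv)
qed

lemma label_le:
  assumes "p \<in> permutations_of_set {1..m}"
  shows "low_label (c # s) p \<le> m" "high_label (c # s) p \<le> m"
proof -
  have "filter (\<lambda>v. v \<le> 0) p = []" "filter (\<lambda>v. m - 0 < v) p = []"
    using assms by (auto simp: permutations_of_set_def filter_empty_conv)
  then have "avoids (filter (\<lambda>v. v \<le> 0) p) (c # s)" "avoids (filter (\<lambda>v. m - 0 < v) p) (c # s)"
    by (simp_all only: avoids_Nil)
  then have "0 \<in> {t. t \<le> m \<and> avoids (filter (\<lambda>v. v \<le> t) p) (c # s)}"
    "0 \<in> {t. t \<le> m \<and> avoids (filter (\<lambda>v. m - t < v) p) (c # s)}" by simp_all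
  then have "{t. t \<le> m \<and> avoids (filter (\<lambda>v. v \<le> t) p) (c # s)} \<noteq> {}"
    "{t. t \<le> m \<and> avoids (filter (\<lambda>v. m - t < v) p) (c # s)} \<noteq> {}" by blast+
  then show "low_label (c # s) p \<le> m" "high_label (c # s) p \<le> m"
    unfolding low_label_def high_label_def permutation_length[OF assms] by simp_all
qed

lemma low_label_eqI:
  assumes "p \<in> permutations_of_set {1..m}" "d \<le> m"
    and "\<And>t. t \<le> m \<Longrightarrow> avoids (filter (\<lambda>v. v \<le> t) p) (c # s) \<longleftrightarrow> t \<le> d"
  shows "low_label (c # s) p = d"
proof -
  have *: "t \<le> low_label (c # s) p \<longleftrightarrow> t \<le> d" if "t \<le> m" for t
    using le_low_label_iff[OF assms(1) that] assms(3)[OF that] by simp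
  show ?thesis using *[of d] *[of "low_label (c # s) p"] label_le(1)[OF assms(1), of c s] assms(2)
    by simp
qed

lemma high_label_eqI:
  assumes "p \<in> permutations_of_set {1..m}" "a \<le> m"
    and "\<And>u. u \<le> m \<Longrightarrow> avoids (filter (\<lambda>v. u < v) p) (c # s) \<longleftrightarrow> m \<le> a + u"
  shows "high_label (c # s) p = a"
proof -
  have *: "m \<le> high_label (c # s) p + u \<longleftrightarrow> m \<le> a + u" if "u \<le> m" for u
    using le_high_label_iff[OF assms(1) that] assms(3)[OF that] by simp
  show ?thesis using *[of "m - a"] *[of "m - high_label (c # s) p"]
      label_le(2)[OF assms(1), of c s] assms(2) by linarith
qed

text \<open>
  A range of values of the extended permutation consists of those new letters that lie in it and of
  the shifted copy of a range of values of \<open>p\<close>. So the new labels can be computed from the old ones.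
\<close>

lemma filter_le_prepend:
  assumes "j \<le> k"
  shows "filter (\<lambda>v. v \<le> t) (prepend j k p) =
     (if j + 1 \<le> t then [j + 1] else []) @ (if k + 2 \<le> t then [k + 2] else []) @
     map (shift j k) (filter (\<lambda>v. v \<le> unshift j k t) p)"
  using shift_le_iff[OF assms] by (simp add: prepend_def filter_map o_def)

lemma filter_greater_prepend:
  assumes "j \<le> k"
  shows "filter (\<lambda>v. t < v) (prepend j k p) =
     (if t < j + 1 then [j + 1] else []) @ (if t < k + 2 then [k + 2] else []) @
     map (shift j k) (filter (\<lambda>v. unshift j k t < v) p)"
  using shift_le_iff[OF assms] by (simp add: prepend_def filter_map o_def not_le[symmetric])

lemma avoids_filter_shift:
  assumes "j \<le> k"
  shows "avoids (filter (\<lambda>v. v < j + 1) (map (shift j k) xs)) s \<longleftrightarrow> avoids (filter (\<lambda>v. v \<le> j) xs) s"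
    "avoids (filter (\<lambda>v. v < k + 2) (map (shift j k) xs)) s \<longleftrightarrow> avoids (filter (\<lambda>v. v \<le> k) xs) s"
    "avoids (filter (\<lambda>v. j + 1 < v) (map (shift j k) xs)) s \<longleftrightarrow> avoids (filter (\<lambda>v. j < v) xs) s"
    "avoids (filter (\<lambda>v. k + 2 < v) (map (shift j k) xs)) s \<longleftrightarrow> avoids (filter (\<lambda>v. k < v) xs) s"
proof -
  have "shift j k v < j + 1 \<longleftrightarrow> v \<le> j" "shift j k v < k + 2 \<longleftrightarrow> v \<le> k"
    "j + 1 < shift j k v \<longleftrightarrow> j < v" "k + 2 < shift j k v \<longleftrightarrow> k < v" for v
    using assms by (auto simp: shift_def)
  then show "avoids (filter (\<lambda>v. v < j + 1) (map (shift j k) xs)) s \<longleftrightarrow> avoids (filter (\<lambda>v. v \<le> j) xs) s"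
    "avoids (filter (\<lambda>v. v < k + 2) (map (shift j k) xs)) s \<longleftrightarrow> avoids (filter (\<lambda>v. v \<le> k) xs) s"
    "avoids (filter (\<lambda>v. j + 1 < v) (map (shift j k) xs)) s \<longleftrightarrow> avoids (filter (\<lambda>v. j < v) xs) s"
    "avoids (filter (\<lambda>v. k + 2 < v) (map (shift j k) xs)) s \<longleftrightarrow> avoids (filter (\<lambda>v. k < v) xs) s"
    by (simp_all only: filter_map o_def avoids_map[OF strict_mono_shift[OF assms]])
qed

text \<open>
  The value for the empty list makes it the root of the 4312-tree with all labels 0: then the
  descent condition on the second new letter is void, as it should be.
\<close>

definition first :: "nat list \<Rightarrow> nat" where
  "first p = (if p = [] then 0 else hd p)"

section \<open>Labels after prepending two letters\<close>

context
  fixes m j k :: nat and p :: "nat list"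
  assumes p: "p \<in> permutations_of_set {1..m}" and jk: "j \<le> k" "k \<le> m"
begin

lemmas prepend_perm = prepend_in_permutations[OF p jk]

lemma avoids_map_shift: "avoids (map (shift j k) xs) s \<longleftrightarrow> avoids xs s"
  by (rule avoids_map[OF strict_mono_shift[OF jk(1)]])

text \<open>
  A new letter can only be the 4, and the first one has a smaller set of entries below it than the
  second one, so only the second letter matters.
\<close>

lemma avoids_prepend_4312:
  "avoids (prepend j k p) [4, 3, 1, 2] \<longleftrightarrow> avoids p [4, 3, 1, 2] \<and> k \<le> low_label [3, 1, 2] p"
proof -
  have "avoids (prepend j k p) [4, 3, 1, 2] \<longleftrightarrow>
     avoids p [4, 3, 1, 2] \<and> avoids (filter (\<lambda>v. v \<le> k) p) [3, 1, 2] \<and> avoids (filter (\<lambda>v. v \<le> j) p) [3, 1, 2]"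
    using jk avoids_filter_shift[OF jk(1)] by (simp add: prepend_def avoids_Cons_max avoids_map_shift)
  then show ?thesis
    using le_low_label_iff[OF p jk(2)] avoids_filter_le_mono[OF jk(1)] by blast
qed

text \<open>
  The first new letter $j+1$ comes before the value $j+2$, so no range beyond $j+1$ avoids 12. If
  $j$ exceeds the old label, the obstruction in \<open>p\<close> itself is met first.
\<close>

lemma low_label_12_prepend:
  "low_label [1, 2] (prepend j k p) = (if j \<le> low_label [1, 2] p then j + 1 else low_label [1, 2] p)"
proof (rule low_label_eqI[OF prepend_perm])
  show "(if j \<le> low_label [1, 2] p then j + 1 else low_label [1, 2] p) \<le> m + 2"
    using label_le(1)[OF p, of 1 "[2]"] jk by simp
  fix t assume t: "t \<le> m + 2"
  consider "t \<le> j" | "j < t" "t \<le> k + 1" | "k + 2 \<le> t" by linarith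
  then show "avoids (filter (\<lambda>v. v \<le> t) (prepend j k p)) [1, 2] \<longleftrightarrow>
     t \<le> (if j \<le> low_label [1, 2] p then j + 1 else low_label [1, 2] p)"
  proof cases
    case 1
    then show ?thesis
      using jk le_low_label_iff[OF p, of t 1 "[2]"]
      by (auto simp: filter_le_prepend unshift_def avoids_map_shift)
  next
    case 2
    have "filter (\<lambda>v. j + 1 < v) (map (shift j k) (filter (\<lambda>v. v \<le> t - 1) p)) = [] \<longleftrightarrow> t = j + 1"
    proof -
      have "avoids (filter (\<lambda>v. j + 1 < v) (map (shift j k) (filter (\<lambda>v. v \<le> t - 1) p))) [2] \<longleftrightarrow>
         avoids (filter (\<lambda>v. j < v) (filter (\<lambda>v. v \<le> t - 1) p)) [2]"
        by (rule avoids_filter_shift(3)[OF jk(1)])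
      also have "\<dots> \<longleftrightarrow> (\<forall>v\<in>{1..m}. \<not> (j < v \<and> v \<le> t - 1))"
        using p by (auto simp: filter_empty_conv permutations_of_set_def)
      also have "\<dots> \<longleftrightarrow> t = j + 1"
      proof
        assume "\<forall>v\<in>{1..m}. \<not> (j < v \<and> v \<le> t - 1)"
        then show "t = j + 1" using 2 jk by (auto dest: bspec[of _ _ "j+1"])
      qed auto
      finally show ?thesis by simp
    qed
    then show ?thesis
      using 2 jk le_low_label_iff[OF p, of "t - 1" 1 "[2]"]
      by (auto simp: filter_le_prepend unshift_def avoids_map_shift avoids_Cons_min)
  next
    case 3
    then show ?thesis
      using jk by (auto simp: filter_le_prepend avoids_Cons_min)
  qed
qed

text \<open>
  A new letter acts as a 3 exactly when the entries of \<open>p\<close> below it contain 12, that is,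
  when there are more of them than the label of 12. The range of values then has to stop just
  before that letter.
\<close>

lemma low_label_312_prepend:
  assumes e: "k \<le> low_label [3, 1, 2] p"
  shows "low_label [3, 1, 2] (prepend j k p) =
     (if j \<le> low_label [1, 2] p
      then if k \<le> low_label [1, 2] p then low_label [3, 1, 2] p + 2 else k + 1
      else j)" (is "_ = ?e")
proof (rule low_label_eqI[OF prepend_perm])
  show "?e \<le> m + 2"
    using label_le(1)[OF p, of 3 "[1, 2]"] jk by simp
  fix t assume t: "t \<le> m + 2"
  have D: "avoids (filter (\<lambda>v. v \<le> j) p) [1, 2] \<longleftrightarrow> j \<le> low_label [1, 2] p"
    "avoids (filter (\<lambda>v. v \<le> k) p) [1, 2] \<longleftrightarrow> k \<le> low_label [1, 2] p"
    using jk by (simp_all add: le_low_label_iff[OF p])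
  have E: "avoids (filter (\<lambda>v. v \<le> u) p) [3, 1, 2] \<longleftrightarrow> u \<le> low_label [3, 1, 2] p" if "u \<le> m" for u
    using that by (simp add: le_low_label_iff[OF p])
  consider "t \<le> j" | "j < t" "t \<le> k + 1" | "k + 2 \<le> t" by linarith
  then show "avoids (filter (\<lambda>v. v \<le> t) (prepend j k p)) [3, 1, 2] \<longleftrightarrow> t \<le> ?e"
  proof cases
    case 1
    then show ?thesis
      using jk e E[of t] by (auto simp: filter_le_prepend unshift_def avoids_map_shift)
  next
    case 2
    then have "avoids (filter (\<lambda>v. v \<le> t) (prepend j k p)) [3, 1, 2] \<longleftrightarrow>
       avoids (filter (\<lambda>v. v \<le> t - 1) p) [3, 1, 2] \<and> avoids (filter (\<lambda>v. v \<le> j) p) [1, 2]"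
      using jk avoids_filter_shift(1)[OF jk(1)]
      by (simp add: filter_le_prepend unshift_def avoids_map_shift avoids_Cons_max filter_filter_le del: filter_filter)
    then show ?thesis
      using 2 jk e E[of "t - 1"] unfolding D by auto
  next
    case 3
    then have "avoids (filter (\<lambda>v. v \<le> t) (prepend j k p)) [3, 1, 2] \<longleftrightarrow>
       avoids (filter (\<lambda>v. v \<le> t - 2) p) [3, 1, 2] \<and> avoids (filter (\<lambda>v. v \<le> j) p) [1, 2] \<and>
       avoids (filter (\<lambda>v. v \<le> k) p) [1, 2]"
      using jk avoids_filter_shift(1,2)[OF jk(1)]
      by (auto simp add: filter_le_prepend unshift_def avoids_map_shift avoids_Cons_max filter_filter_le simp del: filter_filter)
    then show ?thesis
      using 3 t jk e E[of "t - 2"] unfolding D by auto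
  qed
qed

text \<open>
  The first new letter must not be the 1, and the pair of new letters must not be the 12, of an
  occurrence. The second letter as a 1 is then no further restriction, as fewer entries are above it.
\<close>

lemma avoids_prepend_1234:
  "avoids (prepend j k p) [1, 2, 3, 4] \<longleftrightarrow> avoids p [1, 2, 3, 4] \<and>
     m \<le> high_label [2, 3, 4] p + j \<and> m \<le> high_label [3, 4] p + k"
proof -
  let ?q = "map (shift j k) p"
  have "avoids (prepend j k p) [1, 2, 3, 4] \<longleftrightarrow> avoids p [1, 2, 3, 4] \<and>
     avoids (filter (\<lambda>v. k + 2 < v) ?q) [2, 3, 4] \<and>
     avoids ((k + 2) # filter (\<lambda>v. j + 1 < v) ?q) [2, 3, 4]"
    using jk by (simp add: prepend_def avoids_Cons_min avoids_map_shift)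
  also have "avoids ((k + 2) # filter (\<lambda>v. j + 1 < v) ?q) [2, 3, 4] \<longleftrightarrow>
     avoids (filter (\<lambda>v. j + 1 < v) ?q) [2, 3, 4] \<and> avoids (filter (\<lambda>v. k + 2 < v) ?q) [3, 4]"
    using jk filter_filter_greater[of "j + 1" "k + 2" ?q]
    by (simp add: avoids_Cons_min del: filter_filter)
  also have "avoids p [1, 2, 3, 4] \<and> avoids (filter (\<lambda>v. k + 2 < v) ?q) [2, 3, 4] \<and>
      avoids (filter (\<lambda>v. j + 1 < v) ?q) [2, 3, 4] \<and> avoids (filter (\<lambda>v. k + 2 < v) ?q) [3, 4] \<longleftrightarrow>
      avoids p [1, 2, 3, 4] \<and> avoids (filter (\<lambda>v. j < v) p) [2, 3, 4] \<and> avoids (filter (\<lambda>v. k < v) p) [3, 4]"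
    unfolding avoids_filter_shift[OF jk(1)]
    using avoids_filter_greater_mono[OF jk(1), of p "[2, 3, 4]"] by blast
  also have "avoids (filter (\<lambda>v. j < v) p) [2, 3, 4] \<longleftrightarrow> m \<le> high_label [2, 3, 4] p + j"
    using jk by (simp add: le_high_label_iff[OF p])
  also have "avoids (filter (\<lambda>v. k < v) p) [3, 4] \<longleftrightarrow> m \<le> high_label [3, 4] p + k"
    using jk by (simp add: le_high_label_iff[OF p])
  finally show ?thesis .
qed

lemma filter_greater_eq_Nil: "filter (\<lambda>v. k < v) (filter (\<lambda>v. t < v) p) = [] \<longleftrightarrow> m \<le> max k t"
proof -
  have "filter (\<lambda>v. k < v) (filter (\<lambda>v. t < v) p) = [] \<longleftrightarrow> (\<forall>v\<in>{1..m}. \<not> (k < v \<and> t < v))"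
    using p by (auto simp: filter_empty_conv permutations_of_set_def)
  also have "\<dots> \<longleftrightarrow> m \<le> max k t"
  proof
    assume *: "\<forall>v\<in>{1..m}. \<not> (k < v \<and> t < v)"
    show "m \<le> max k t"
    proof (rule ccontr)
      assume "\<not> m \<le> max k t"
      then have "m \<in> {1..m}" "k < m \<and> t < m" by (auto simp: max_def split: if_splits)
      then show False using * by blast
    qed
  qed (auto simp: max_def split: if_splits)
  finally show ?thesis .
qed

text \<open>
  If some entry is above the second new letter, then this letter starts an occurrence of 12 and bounds
  the range of largest values. Otherwise $k = m$, this letter is the maximum, and the bound comes
  from \<open>p\<close> or from the first new letter, whichever is met first.
\<close>

lemma high_label_12_prepend:
  assumes a: "m \<le> high_label [3, 4] p + k"
  shows "high_label [3, 4] (prepend j k p) =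
     (if k < m then m - k else min (m - j) (high_label [3, 4] p) + 1)" (is "_ = ?a")
proof (rule high_label_eqI[OF prepend_perm])
  show "?a \<le> m + 2" by (auto simp: min_def)
  fix t assume t: "t \<le> m + 2"
  consider "t \<le> j" | "j < t" "t \<le> k + 1" | "k + 2 \<le> t" by linarith
  then show "avoids (filter (\<lambda>v. t < v) (prepend j k p)) [3, 4] \<longleftrightarrow> m + 2 \<le> ?a + t"
  proof cases
    case 1
    then show ?thesis
      using jk by (auto simp: filter_greater_prepend avoids_Cons_min)
  next
    case 2
    then obtain u where u: "t = Suc u" by (cases t) simp_all
    have "avoids (filter (\<lambda>v. t < v) (prepend j k p)) [3, 4] \<longleftrightarrow>
      avoids (filter (\<lambda>v. u < v) p) [3, 4] \<and> filter (\<lambda>v. k < v) (filter (\<lambda>v. u < v) p) = []"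
      using 2 jk u avoids_filter_shift(4)[OF jk(1), of "filter (\<lambda>v. u < v) p" "[4]"]
      by (simp add: filter_greater_prepend unshift_def avoids_map_shift avoids_Cons_min del: filter_filter)
    then show ?thesis
      unfolding filter_greater_eq_Nil
      using 2 u jk le_high_label_iff[OF p, of u 3 "[4]"] by (auto simp: min_def)
  next
    case 3
    define u where "u = t - 2"
    then have u: "t = Suc (Suc u)" using 3 by simp
    have "avoids (filter (\<lambda>v. t < v) (prepend j k p)) [3, 4] \<longleftrightarrow> m \<le> high_label [3, 4] p + u"
      using 3 t jk u le_high_label_iff[OF p, of u 3 "[4]"]
      by (simp add: filter_greater_prepend unshift_def avoids_map_shift)
    then show ?thesis using 3 t jk a u by auto
  qed
qed

text \<open>
  The first new letter is the 1 of an occurrence of 123 as soon as two entries above it ascend: either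
  the second new letter followed by a larger entry of \<open>p\<close>, or two entries of \<open>p\<close>.
\<close>

lemma high_label_123_prepend:
  assumes a: "m \<le> high_label [3, 4] p + k" and b: "m \<le> high_label [2, 3, 4] p + j"
  shows "high_label [2, 3, 4] (prepend j k p) =
     (if k = m \<and> m \<le> high_label [3, 4] p + j then high_label [2, 3, 4] p + 2 else m - j + 1)" (is "_ = ?b")
proof (rule high_label_eqI[OF prepend_perm])
  show "?b \<le> m + 2" using label_le(2)[OF p, of 2 "[3, 4]"] by auto
  fix t assume t: "t \<le> m + 2"
  have D: "avoids (filter (\<lambda>v. j < v) p) [3, 4] \<longleftrightarrow> m \<le> high_label [3, 4] p + j"
    "avoids (filter (\<lambda>v. k < v) p) [3, 4]"
    using jk a by (simp_all add: le_high_label_iff[OF p, symmetric])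
  have E: "avoids (filter (\<lambda>v. u < v) p) [2, 3, 4] \<longleftrightarrow> m \<le> high_label [2, 3, 4] p + u" if "u \<le> m" for u
    using that by (simp add: le_high_label_iff[OF p])
  consider "t \<le> j" | "j < t" "t \<le> k + 1" | "k + 2 \<le> t" by linarith
  then show "avoids (filter (\<lambda>v. t < v) (prepend j k p)) [2, 3, 4] \<longleftrightarrow> m + 2 \<le> ?b + t"
  proof cases
    case 1
    then have "avoids (filter (\<lambda>v. t < v) (prepend j k p)) [2, 3, 4] \<longleftrightarrow>
      avoids (filter (\<lambda>v. t < v) p) [2, 3, 4] \<and> avoids (filter (\<lambda>v. j < v) p) [3, 4] \<and> m \<le> k"
    proof -
      let ?q = "map (shift j k) (filter (\<lambda>v. t < v) p)"
      have "avoids (filter (\<lambda>v. t < v) (prepend j k p)) [2, 3, 4] \<longleftrightarrow>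
        avoids (filter (\<lambda>v. t < v) p) [2, 3, 4] \<and> avoids (filter (\<lambda>v. k + 2 < v) ?q) [3, 4] \<and>
        avoids (filter (\<lambda>v. j + 1 < v) ((k + 2) # ?q)) [3, 4]"
        using 1 jk by (simp add: filter_greater_prepend unshift_def avoids_Cons_min avoids_map_shift)
      also have "avoids (filter (\<lambda>v. j + 1 < v) ((k + 2) # ?q)) [3, 4] \<longleftrightarrow>
        avoids (filter (\<lambda>v. j + 1 < v) ?q) [3, 4] \<and> avoids (filter (\<lambda>v. k + 2 < v) ?q) [4]"
        using jk filter_filter_greater[of "j + 1" "k + 2" ?q]
        by (simp add: avoids_Cons_min del: filter_filter avoids_singleton)
      finally show ?thesis
        unfolding avoids_filter_shift[OF jk(1)] unfolding avoids_singleton filter_greater_eq_Nil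
        using 1 jk D(2) filter_filter_greater[of t j p] filter_filter_greater[of t k p] by simp
    qed
    then show ?thesis
      using 1 jk E[of t] unfolding D by auto
  next
    case 2
    then have "avoids (filter (\<lambda>v. t < v) (prepend j k p)) [2, 3, 4] \<longleftrightarrow>
      avoids (filter (\<lambda>v. t - 1 < v) p) [2, 3, 4] \<and> avoids (filter (\<lambda>v. k < v) p) [3, 4]"
      using jk avoids_filter_shift(4)[OF jk(1)]
      by (simp add: filter_greater_prepend unshift_def avoids_map_shift avoids_Cons_min filter_filter_greater del: filter_filter)
    then show ?thesis
      using 2 jk b D E[of "t - 1"] by auto
  next
    case 3
    then show ?thesis
      using t jk b E[of "t - 2"]
      by (auto simp: filter_greater_prepend unshift_def avoids_map_shift)
  qed
qed

end

section \<open>One step in the two generating trees\<close>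

text \<open>
  The sum of \<open>\<Psi>\<close> over the labels of the children of a node with labels $f, d, e$ of the 4312-tree;
  \<open>j\<close> and \<open>k\<close> are the numbers of entries below the two new letters.
\<close>

definition grow_4312 :: "(nat \<Rightarrow> nat \<Rightarrow> nat \<Rightarrow> nat) \<Rightarrow> nat \<Rightarrow> nat \<Rightarrow> nat \<Rightarrow> nat" where
  "grow_4312 \<Psi> f d e = (\<Sum>k=f..e. \<Sum>j=0..k.
     if j \<le> d then \<Psi> (j + 1) (j + 1) (if k \<le> d then e + 2 else k + 1) else \<Psi> (j + 1) d j)"

text \<open>
  The corresponding sum for a node with labels $a, b$ of the 1234-tree.
\<close>

definition grow_high :: "(nat \<Rightarrow> nat \<Rightarrow> nat) \<Rightarrow> nat \<Rightarrow> nat \<Rightarrow> nat" where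
  "grow_high \<Phi> a b = (\<Sum>i=0..a. \<Sum>q=i..b.
     \<Phi> (if i = 0 then min q a + 1 else i) (if i = 0 \<and> q \<le> a then b + 2 else q + 1))"

lemma sum_step_4312:
  "(\<Sum>r\<in>alternating_avoiding (m + 2) [4, 3, 1, 2].
      \<Psi> (first r) (low_label [1, 2] r) (low_label [3, 1, 2] r)) =
   (\<Sum>p\<in>alternating_avoiding m [4, 3, 1, 2].
      grow_4312 \<Psi> (first p) (low_label [1, 2] p) (low_label [3, 1, 2] p))"
proof -
  have "(\<Sum>r\<in>alternating_avoiding (m + 2) [4, 3, 1, 2].
      \<Psi> (first r) (low_label [1, 2] r) (low_label [3, 1, 2] r)) =
    (\<Sum>p\<in>alternating_avoiding m [4, 3, 1, 2]. \<Sum>k | k \<le> m \<and> (p \<noteq> [] \<longrightarrow> hd p \<le> k).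
       \<Sum>j | j \<le> k \<and> k \<le> low_label [3, 1, 2] p.
         \<Psi> (first (prepend j k p)) (low_label [1, 2] (prepend j k p)) (low_label [3, 1, 2] (prepend j k p)))"
    by (rule sum_alternating_avoiding_prepend[where ok = "\<lambda>p k j. k \<le> low_label [3, 1, 2] p"])
      (rule avoids_prepend_4312)
  also have "\<dots> = (\<Sum>p\<in>alternating_avoiding m [4, 3, 1, 2].
      grow_4312 \<Psi> (first p) (low_label [1, 2] p) (low_label [3, 1, 2] p))"
  proof (rule sum.cong[OF refl])
    fix p assume "p \<in> alternating_avoiding m [4, 3, 1, 2]"
    then have p: "p \<in> permutations_of_set {1..m}" by (simp add: alternating_avoiding_def)
    have e: "low_label [3, 1, 2] p \<le> m" by (rule label_le(1)[OF p])
    show "(\<Sum>k | k \<le> m \<and> (p \<noteq> [] \<longrightarrow> hd p \<le> k). \<Sum>j | j \<le> k \<and> k \<le> low_label [3, 1, 2] p.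
         \<Psi> (first (prepend j k p)) (low_label [1, 2] (prepend j k p)) (low_label [3, 1, 2] (prepend j k p)))
      = grow_4312 \<Psi> (first p) (low_label [1, 2] p) (low_label [3, 1, 2] p)"
      unfolding grow_4312_def
    proof (rule sum.mono_neutral_cong_right)
      show "{first p..low_label [3, 1, 2] p} \<subseteq> {k. k \<le> m \<and> (p \<noteq> [] \<longrightarrow> hd p \<le> k)}"
        using e by (auto simp: first_def)
      show "\<forall>k\<in>{k. k \<le> m \<and> (p \<noteq> [] \<longrightarrow> hd p \<le> k)} - {first p..low_label [3, 1, 2] p}.
        (\<Sum>j | j \<le> k \<and> k \<le> low_label [3, 1, 2] p. \<Psi> (first (prepend j k p))
          (low_label [1, 2] (prepend j k p)) (low_label [3, 1, 2] (prepend j k p))) = 0"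
        by (auto simp: first_def)
      fix k assume k: "k \<in> {first p..low_label [3, 1, 2] p}"
      show "(\<Sum>j | j \<le> k \<and> k \<le> low_label [3, 1, 2] p. \<Psi> (first (prepend j k p))
          (low_label [1, 2] (prepend j k p)) (low_label [3, 1, 2] (prepend j k p))) =
        (\<Sum>j=0..k. if j \<le> low_label [1, 2] p
          then \<Psi> (j + 1) (j + 1) (if k \<le> low_label [1, 2] p then low_label [3, 1, 2] p + 2 else k + 1)
          else \<Psi> (j + 1) (low_label [1, 2] p) j)"
      proof (rule sum.cong)
        show "{j. j \<le> k \<and> k \<le> low_label [3, 1, 2] p} = {0..k}" using k by auto
        fix j assume "j \<in> {0..k}"
        then have j: "j \<le> k" "k \<le> m" "k \<le> low_label [3, 1, 2] p" using k e by simp_all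
        have "first (prepend j k p) = j + 1" by (simp add: first_def prepend_def)
        then show "\<Psi> (first (prepend j k p)) (low_label [1, 2] (prepend j k p)) (low_label [3, 1, 2] (prepend j k p)) =
          (if j \<le> low_label [1, 2] p
          then \<Psi> (j + 1) (j + 1) (if k \<le> low_label [1, 2] p then low_label [3, 1, 2] p + 2 else k + 1)
          else \<Psi> (j + 1) (low_label [1, 2] p) j)"
          using low_label_12_prepend[OF p j(1,2)] low_label_312_prepend[OF p j] by simp
      qed
    qed simp
  qed
  finally show ?thesis .
qed

text \<open>
  In the 1234-tree the descent to the first letter of \<open>p\<close> is automatic: $\pi_1 < \pi_2$ is an
  occurrence of 12, which the entries above the second new letter have to avoid. This is where even
  length enters, as it provides $\pi_2$.
\<close>

lemma alternating_first_le:
  assumes p: "p \<in> permutations_of_set {1..m}" and alt: "alternating p" and "even m" "k \<le> m"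
    and a: "m \<le> high_label [3, 4] p + k" and "p \<noteq> []"
  shows "hd p \<le> k"
proof (rule ccontr)
  assume k: "\<not> hd p \<le> k"
  have "length p = m" by (rule permutation_length[OF p])
  then have "even (length p)" using assms(3) by simp
  then obtain x y q where xyq: "p = x # y # q"
    using \<open>p \<noteq> []\<close> by (cases p; cases "tl p") auto
  then have "x < y" using alt by (simp add: alternating_Cons_Cons)
  have "avoids (filter (\<lambda>v. k < v) p) [3, 4]"
    using a \<open>k \<le> m\<close> by (simp add: le_high_label_iff[OF p])
  then show False using k \<open>x < y\<close> xyq by (simp add: avoids_Cons_min)
qed

text \<open>
  The summation indices of \<open>grow_high\<close> are $i = m - k$ and $q = m - j$, the numbers of entries of
  \<open>p\<close> above the two new letters.
\<close>

lemma sum_step_1234: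
  assumes "even m"
  shows "(\<Sum>r\<in>alternating_avoiding (m + 2) [1, 2, 3, 4].
      \<Phi> (high_label [3, 4] r) (high_label [2, 3, 4] r)) =
   (\<Sum>p\<in>alternating_avoiding m [1, 2, 3, 4]. grow_high \<Phi> (high_label [3, 4] p) (high_label [2, 3, 4] p))"
proof -
  let ?ok = "\<lambda>p k j. m \<le> high_label [2, 3, 4] p + j \<and> m \<le> high_label [3, 4] p + k"
  have "(\<Sum>r\<in>alternating_avoiding (m + 2) [1, 2, 3, 4].
      \<Phi> (high_label [3, 4] r) (high_label [2, 3, 4] r)) =
    (\<Sum>p\<in>alternating_avoiding m [1, 2, 3, 4]. \<Sum>k | k \<le> m \<and> (p \<noteq> [] \<longrightarrow> hd p \<le> k).
       \<Sum>j | j \<le> k \<and> ?ok p k j. \<Phi> (high_label [3, 4] (prepend j k p)) (high_label [2, 3, 4] (prepend j k p)))"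
    by (rule sum_alternating_avoiding_prepend) (rule avoids_prepend_1234)
  also have "\<dots> = (\<Sum>p\<in>alternating_avoiding m [1, 2, 3, 4].
      grow_high \<Phi> (high_label [3, 4] p) (high_label [2, 3, 4] p))"
  proof (rule sum.cong[OF refl])
    fix p assume "p \<in> alternating_avoiding m [1, 2, 3, 4]"
    then have p: "p \<in> permutations_of_set {1..m}" "alternating p" by (simp_all add: alternating_avoiding_def)
    define a b where "a = high_label [3, 4] p" and "b = high_label [2, 3, 4] p"
    have ab: "a \<le> m" "b \<le> m" unfolding a_def b_def by (rule label_le(2)[OF p(1)])+
    define G where "G k = (\<Sum>j | j \<le> k \<and> ?ok p k j.
        \<Phi> (high_label [3, 4] (prepend j k p)) (high_label [2, 3, 4] (prepend j k p)))" for k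
    have "(\<Sum>k | k \<le> m \<and> (p \<noteq> [] \<longrightarrow> hd p \<le> k). G k) = (\<Sum>k=m-a..m. G k)"
    proof (rule sum.mono_neutral_right)
      show "{m-a..m} \<subseteq> {k. k \<le> m \<and> (p \<noteq> [] \<longrightarrow> hd p \<le> k)}"
        using alternating_first_le[OF p \<open>even m\<close>] by (auto simp: a_def)
      show "\<forall>k\<in>{k. k \<le> m \<and> (p \<noteq> [] \<longrightarrow> hd p \<le> k)} - {m-a..m}. G k = 0"
      proof
        fix k assume "k \<in> {k. k \<le> m \<and> (p \<noteq> [] \<longrightarrow> hd p \<le> k)} - {m-a..m}"
        then have "\<not> m \<le> high_label [3, 4] p + k" by (auto simp: a_def)
        then show "G k = 0" by (simp add: G_def)
      qed
    qed simp
    also have "\<dots> = (\<Sum>i=0..a. G (m - i))"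
      by (rule sum.reindex_bij_witness[of _ "\<lambda>i. m - i" "\<lambda>k. m - k"]) (use ab in auto)
    also have "\<dots> = grow_high \<Phi> a b"
      unfolding grow_high_def
    proof (rule sum.cong[OF refl])
      fix i assume "i \<in> {0..a}"
      then have i: "i \<le> a" "i \<le> m" using ab by simp_all
      show "G (m - i) = (\<Sum>q=i..b.
        \<Phi> (if i = 0 then min q a + 1 else i) (if i = 0 \<and> q \<le> a then b + 2 else q + 1))"
        unfolding G_def
      proof (rule sum.reindex_bij_witness[of _ "\<lambda>q. m - q" "\<lambda>j. m - j"])
        fix j assume "j \<in> {j. j \<le> m - i \<and> ?ok p (m - i) j}"
        then have j: "j \<le> m - i" "m \<le> b + j" "m \<le> a + (m - i)" by (simp_all add: a_def b_def)
        show "m - (m - j) = j" "m - j \<in> {i..b}" using j i by auto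
        have "high_label [3, 4] (prepend j (m - i) p) = (if i = 0 then min (m - j) a + 1 else i)"
          using high_label_12_prepend[OF p(1) j(1) diff_le_self] j(3) i by (simp add: a_def)
        moreover have "high_label [2, 3, 4] (prepend j (m - i) p) = (if i = 0 \<and> m - j \<le> a then b + 2 else m - j + 1)"
          using high_label_123_prepend[OF p(1) j(1) diff_le_self] j(2,3) i by (auto simp: a_def b_def)
        ultimately show "\<Phi> (if i = 0 then min (m - j) a + 1 else i) (if i = 0 \<and> m - j \<le> a then b + 2 else m - j + 1) =
          \<Phi> (high_label [3, 4] (prepend j (m - i) p)) (high_label [2, 3, 4] (prepend j (m - i) p))"
          by (simp only:)
      next
        fix q assume "q \<in> {i..b}"
        then show "m - (m - q) = q" "m - q \<in> {j. j \<le> m - i \<and> ?ok p (m - i) j}"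
          using i ab by (auto simp: a_def b_def)
      qed
    qed
    finally show "(\<Sum>k | k \<le> m \<and> (p \<noteq> [] \<longrightarrow> hd p \<le> k). \<Sum>j | j \<le> k \<and> ?ok p k j.
        \<Phi> (high_label [3, 4] (prepend j k p)) (high_label [2, 3, 4] (prepend j k p)))
      = grow_high \<Phi> (high_label [3, 4] p) (high_label [2, 3, 4] p)"
      by (simp only: G_def a_def b_def)
  qed
  finally show ?thesis .
qed

section \<open>Comparison of the generating trees\<close>

text \<open>
  The operators $K$, $H$, $V$ of the introduction. The factor in \<open>barren\<close> is a multiplicity: it is
  the number of possible second letters of a child whose first letter is $b+1$.
\<close>

definition grow_1234 :: "(nat \<Rightarrow> nat \<Rightarrow> nat) \<Rightarrow> nat \<Rightarrow> nat \<Rightarrow> nat" where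
  "grow_1234 \<Phi> a b = (\<Sum>x=1..a+1. \<Sum>y=x+1..b+2. \<Phi> x y)"

definition fertile :: "(nat \<Rightarrow> nat \<Rightarrow> nat) \<Rightarrow> nat \<Rightarrow> nat \<Rightarrow> nat" where
  "fertile \<Phi> d e = (\<Sum>w=1..d+1. \<Sum>y=d+2..e+2. \<Phi> w y)"

definition barren :: "(nat \<Rightarrow> nat \<Rightarrow> nat) \<Rightarrow> nat \<Rightarrow> nat \<Rightarrow> nat" where
  "barren \<Phi> d e = (\<Sum>b=d+1..e. (e + 1 - b) * \<Phi> d b)"

text \<open>
  Summation by parts.
\<close>

lemma sum_weighted_eq_sum_partial_sums:
  fixes \<phi> :: "nat \<Rightarrow> nat"
  shows "(\<Sum>b=l..u. (u + 1 - b) * \<phi> b) = (\<Sum>k=l..u. \<Sum>b=l..k. \<phi> b)"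
proof (induction u)
  case 0
  then show ?case by (cases "l = 0") auto
next
  case (Suc u)
  show ?case
  proof (cases "l \<le> Suc u")
    case True
    have "(\<Sum>b=l..Suc u. (Suc u + 1 - b) * \<phi> b)
        = (\<Sum>b=l..Suc u. (u + 1 - b) * \<phi> b + \<phi> b)"
      by (rule sum.cong) (auto simp: Suc_diff_le)
    also have "\<dots> = (\<Sum>b=l..u. (u + 1 - b) * \<phi> b) + (\<Sum>b=l..Suc u. \<phi> b)"
      using True by (simp add: sum.distrib)
    finally show ?thesis using Suc True by simp
  qed simp
qed

text \<open>
  The intertwining identity below, with $\Phi$ restricted to one value $x$ of its first argument and after
  cancellation of the terms common to both sides. In terms of the partial sums
  $P(k) = \sum_{z=x+1}^{k} \varphi(z)$ both sides have the same coefficients: $P(k)$ occurs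
  $e+1-d$ times if $k \le d+2$, and $e+3-k$ times if $d+2 < k \le e+2$.
\<close>

lemma barren_row_identity:
  fixes \<phi> :: "nat \<Rightarrow> nat"
  assumes "d \<le> e" "x \<le> d + 1"
  shows "(\<Sum>y=d+2..e+2. \<Sum>b=x+1..y. (y + 1 - b) * \<phi> b) =
     (\<Sum>w=x..d+1. \<Sum>y=d+2..e+2. \<Sum>z=x+1..w+1. \<phi> z) +
     (\<Sum>b=d+1..e. (e + 1 - b) * (\<Sum>z=x+1..b+2. \<phi> z))"
proof -
  define P where "P k = (\<Sum>z=x+1..k. \<phi> z)" for k
  have P_low: "(\<Sum>w=x..d+1. \<Sum>y=d+2..e'+2. P (w+1)) = (e' + 1 - d) * (\<Sum>k=x+1..d+2. P k)" for e'
  proof -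
    have "(\<Sum>w=x..d+1. P (w+1)) = (\<Sum>k=x+1..d+2. P k)"
      using sum.shift_bounds_cl_Suc_ivl[of P x "d+1"] by simp
    then show ?thesis by (simp add: sum_distrib_left[symmetric])
  qed
  have "(\<Sum>y=d+2..e+2. \<Sum>k=x+1..y. P k) =
      (e + 1 - d) * (\<Sum>k=x+1..d+2. P k) + (\<Sum>b=d+1..e. (e + 1 - b) * P (b + 2))"
    using assms(1)
  proof (induction e rule: dec_induct)
    case base
    then show ?case by simp
  next
    case (step e)
    have split: "(\<Sum>k=x+1..Suc e+2. P k) = (\<Sum>k=x+1..d+2. P k) + (\<Sum>b=d+1..Suc e. P (b + 2))"
    proof -
      have "(\<Sum>b=d+1..Suc e. P (b + 2)) = (\<Sum>k=d+2+1..Suc e+2. P k)"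
        using sum.shift_bounds_cl_nat_ivl[of P "d+1" 2 "Suc e"] by simp
      moreover have "(\<Sum>k=x+1..d+2. P k) + (\<Sum>k=d+2+1..Suc e+2. P k) = (\<Sum>k=x+1..Suc e+2. P k)"
        using sum.ub_add_nat[of "x+1" "d+2" P "Suc e - d"] step assms(2) by simp
      ultimately show ?thesis by simp
    qed
    have "(\<Sum>b=d+1..Suc e. (Suc e + 1 - b) * P (b + 2))
        = (\<Sum>b=d+1..Suc e. (e + 1 - b) * P (b + 2) + P (b + 2))"
      by (rule sum.cong) (auto simp: Suc_diff_le)
    also have "\<dots> = (\<Sum>b=d+1..e. (e + 1 - b) * P (b + 2)) + (\<Sum>b=d+1..Suc e. P (b + 2))"
      using step by (simp add: sum.distrib)
    finally have w: "(\<Sum>b=d+1..Suc e. (Suc e + 1 - b) * P (b + 2)) = \<dots>" .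
    have c: "Suc e + 1 - d = (e + 1 - d) + 1" using step by simp
    have "(\<Sum>y=d+2..Suc e+2. \<Sum>k=x+1..y. P k) =
       (\<Sum>y=d+2..e+2. \<Sum>k=x+1..y. P k) + (\<Sum>k=x+1..Suc e+2. P k)"
      using step by simp
    then show ?case
      unfolding w c step.IH split by (simp add: algebra_simps)
  qed
  then show ?thesis
    unfolding sum_weighted_eq_sum_partial_sums
    using P_low[of e] unfolding P_def by simp
qed

text \<open>
  The fertile children of a fertile child with labels $(w,y)$ are exactly those of its 1234-children
  $(x,z)$ with $z \ge w+2$; what remains of $HK$ after this comparison is the region $x < z \le w+1$,
  and together with $VK$ it must match $HV$. For each fixed $x$ this is the preceding lemma.
\<close>

lemma fertile_barren_intertwine:
  assumes "d \<le> e"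
  shows "fertile (\<lambda>a b. fertile \<Phi> a b + barren \<Phi> a b) d e = fertile (grow_1234 \<Phi>) d e + barren (grow_1234 \<Phi>) d e"
proof -
  have K_split: "grow_1234 \<Phi> w y = fertile \<Phi> w y + (\<Sum>x=1..w. \<Sum>z=x+1..w+1. \<Phi> x z)" if "w < y" for w y
  proof -
    have "(\<Sum>z=x+1..y+2. \<Phi> x z) = (\<Sum>z=w+2..y+2. \<Phi> x z) + (\<Sum>z=x+1..w+1. \<Phi> x z)"
      if "x \<in> {1..w+1}" for x
      using sum.ub_add_nat[of "x+1" "w+1" "\<Phi> x" "y+1-w"] that \<open>w < y\<close> by simp
    then have "grow_1234 \<Phi> w y = (\<Sum>x=1..w+1. (\<Sum>z=w+2..y+2. \<Phi> x z) + (\<Sum>z=x+1..w+1. \<Phi> x z))"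
      unfolding grow_1234_def by (rule sum.cong[OF refl])
    also have "\<dots> = fertile \<Phi> w y + (\<Sum>x=1..w+1. \<Sum>z=x+1..w+1. \<Phi> x z)"
      by (simp only: sum.distrib fertile_def)
    finally show ?thesis by simp
  qed
  have swap: "(\<Sum>w=1..d+1. \<Sum>y=d+2..e+2. \<Sum>x=1..w. \<Sum>z=x+1..w+1. \<Phi> x z) =
     (\<Sum>x=1..d+1. \<Sum>w=x..d+1. \<Sum>y=d+2..e+2. \<Sum>z=x+1..w+1. \<Phi> x z)"
  proof -
    have "(\<Sum>w=1..d+1. \<Sum>y=d+2..e+2. \<Sum>x=1..w. \<Sum>z=x+1..w+1. \<Phi> x z) =
       (\<Sum>w=1..d+1. \<Sum>x=1..w. \<Sum>y=d+2..e+2. \<Sum>z=x+1..w+1. \<Phi> x z)"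
      by (subst sum.swap) (rule refl)
    also have "\<dots> = (\<Sum>(w,x)\<in>(SIGMA w:{1..d+1}. {1..w}). \<Sum>y=d+2..e+2. \<Sum>z=x+1..w+1. \<Phi> x z)"
      by (rule sum.Sigma) auto
    also have "\<dots> = (\<Sum>(x,w)\<in>(SIGMA x:{1..d+1}. {x..d+1}). \<Sum>y=d+2..e+2. \<Sum>z=x+1..w+1. \<Phi> x z)"
      by (rule sum.reindex_bij_witness[of _ prod.swap prod.swap]) auto
    also have "\<dots> = (\<Sum>x=1..d+1. \<Sum>w=x..d+1. \<Sum>y=d+2..e+2. \<Sum>z=x+1..w+1. \<Phi> x z)"
      by (rule sum.Sigma[symmetric]) auto
    finally show ?thesis .
  qed
  have HK: "fertile (grow_1234 \<Phi>) d e = fertile (fertile \<Phi>) d e +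
      (\<Sum>w=1..d+1. \<Sum>y=d+2..e+2. \<Sum>x=1..w. \<Sum>z=x+1..w+1. \<Phi> x z)"
  proof -
    have "fertile (grow_1234 \<Phi>) d e = (\<Sum>w=1..d+1. \<Sum>y=d+2..e+2. fertile \<Phi> w y + (\<Sum>x=1..w. \<Sum>z=x+1..w+1. \<Phi> x z))"
      unfolding fertile_def[of "grow_1234 \<Phi>"] by (intro sum.cong refl K_split) auto
    then show ?thesis by (simp only: sum.distrib fertile_def[of "fertile \<Phi>"])
  qed
  have VK: "barren (grow_1234 \<Phi>) d e = (\<Sum>x=1..d+1. \<Sum>b=d+1..e. (e+1-b) * (\<Sum>z=x+1..b+2. \<Phi> x z))"
    unfolding barren_def grow_1234_def sum_distrib_left by (subst sum.swap) (rule refl)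
  have "fertile (barren \<Phi>) d e = (\<Sum>x=1..d+1. (\<Sum>w=x..d+1. \<Sum>y=d+2..e+2. \<Sum>z=x+1..w+1. \<Phi> x z) +
     (\<Sum>b=d+1..e. (e + 1 - b) * (\<Sum>z=x+1..b+2. \<Phi> x z)))"
    unfolding fertile_def barren_def using assms by (intro sum.cong refl barren_row_identity) auto
  also have "\<dots> = (\<Sum>w=1..d+1. \<Sum>y=d+2..e+2. \<Sum>x=1..w. \<Sum>z=x+1..w+1. \<Phi> x z) + barren (grow_1234 \<Phi>) d e"
    unfolding VK swap by (rule sum.distrib)
  finally have HV: "fertile (barren \<Phi>) d e = \<dots>" .
  have "fertile (\<lambda>a b. fertile \<Phi> a b + barren \<Phi> a b) d e = fertile (fertile \<Phi>) d e + fertile (barren \<Phi>) d e"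
    by (simp only: fertile_def[of "\<lambda>a b. fertile \<Phi> a b + barren \<Phi> a b"] fertile_def[of "fertile \<Phi>"] fertile_def[of "barren \<Phi>"] sum.distrib)
  then show ?thesis using HK HV by simp
qed

text \<open>
  The children with $i \ge 1$ have the labels $(x,y)$ with $x \le a$ and $y \le b+1$. The child
  with $i = 0$ and given $q$ has $y = b+2$ if $q \le a$ and $x = a+1$ if $q > a$, and
  fills the remaining border of the region.
\<close>

lemma grow_high_eq_grow_1234:
  assumes "a \<le> b"
  shows "grow_high \<Phi> a b = grow_1234 \<Phi> a b"
proof -
  let ?S = "\<Sum>x=1..a. \<Sum>y=x+1..b+1. \<Phi> x y"
  have "grow_high \<Phi> a b = (\<Sum>q=0..b. \<Phi> (min q a + 1) (if q \<le> a then b + 2 else q + 1)) +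
     (\<Sum>i=1..a. \<Sum>q=i..b. \<Phi> i (q + 1))"
    unfolding grow_high_def by (subst sum.atLeast_Suc_atMost) simp_all
  also have "(\<Sum>i=1..a. \<Sum>q=i..b. \<Phi> i (q + 1)) = ?S"
    using sum.shift_bounds_cl_Suc_ivl[of "\<Phi> x" x b for x] by simp
  also have "(\<Sum>q=0..b. \<Phi> (min q a + 1) (if q \<le> a then b + 2 else q + 1)) =
      (\<Sum>q=0..a. \<Phi> (q + 1) (b + 2)) + (\<Sum>q=a+1..b. \<Phi> (a + 1) (q + 1))"
  proof -
    let ?g = "\<lambda>q. \<Phi> (min q a + 1) (if q \<le> a then b + 2 else q + 1)"
    have "sum ?g {0..b} = sum ?g {0..a} + sum ?g {a+1..b}"
      using sum.ub_add_nat[of 0 a ?g "b - a"] assms by simp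
    also have "sum ?g {0..a} = (\<Sum>q=0..a. \<Phi> (q + 1) (b + 2))"
      by (rule sum.cong) auto
    also have "sum ?g {a+1..b} = (\<Sum>q=a+1..b. \<Phi> (a + 1) (q + 1))"
      by (rule sum.cong) auto
    finally show ?thesis .
  qed
  also have "(\<Sum>q=0..a. \<Phi> (q + 1) (b + 2)) = (\<Sum>x=1..a+1. \<Phi> x (b + 2))"
    using sum.shift_bounds_cl_Suc_ivl[of "\<lambda>x. \<Phi> x (b + 2)" 0 a] by simp
  also have "(\<Sum>q=a+1..b. \<Phi> (a + 1) (q + 1)) = (\<Sum>y=a+2..b+1. \<Phi> (a + 1) y)"
    using sum.shift_bounds_cl_Suc_ivl[of "\<Phi> (a + 1)" "a + 1" b] by simp
  finally have 1: "grow_high \<Phi> a b =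
    (\<Sum>x=1..a+1. \<Phi> x (b + 2)) + (\<Sum>y=a+2..b+1. \<Phi> (a + 1) y) + ?S" .
  have "grow_1234 \<Phi> a b = (\<Sum>x=1..a+1. (\<Sum>y=x+1..b+1. \<Phi> x y) + \<Phi> x (b + 2))"
    unfolding grow_1234_def using assms by (intro sum.cong refl) simp
  also have "\<dots> = ?S + (\<Sum>y=a+2..b+1. \<Phi> (a + 1) y) + (\<Sum>x=1..a+1. \<Phi> x (b + 2))"
    by (simp only: sum.distrib) simp
  finally show ?thesis using 1 by simp
qed

lemma grow_4312_diagonal:
  assumes "d \<le> e"
  shows "grow_4312 \<Psi> d d e = fertile (\<lambda>w y. \<Psi> w w y) d e + (\<Sum>b=d+1..e. (e + 1 - b) * \<Psi> (b + 1) d b)"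
proof -
  let ?y = "\<lambda>k. if k \<le> d then e + 2 else k + 1"
  have "grow_4312 \<Psi> d d e = (\<Sum>k=d..e. (\<Sum>j=0..d. \<Psi> (j + 1) (j + 1) (?y k)) + (\<Sum>j=d+1..k. \<Psi> (j + 1) d j))"
    unfolding grow_4312_def
  proof (rule sum.cong[OF refl])
    fix k assume k: "k \<in> {d..e}"
    let ?g = "\<lambda>j. if j \<le> d then \<Psi> (j + 1) (j + 1) (?y k) else \<Psi> (j + 1) d j"
    have "sum ?g {0..k} = sum ?g {0..d} + sum ?g {d+1..k}"
      using sum.ub_add_nat[of 0 d ?g "k - d"] k by simp
    also have "sum ?g {0..d} = (\<Sum>j=0..d. \<Psi> (j + 1) (j + 1) (?y k))" by (rule sum.cong) auto
    also have "sum ?g {d+1..k} = (\<Sum>j=d+1..k. \<Psi> (j + 1) d j)" by (rule sum.cong) auto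
    finally show "sum ?g {0..k} =
      (\<Sum>j=0..d. \<Psi> (j + 1) (j + 1) (?y k)) + (\<Sum>j=d+1..k. \<Psi> (j + 1) d j)" .
  qed
  also have "\<dots> = (\<Sum>j=0..d. \<Sum>k=d..e. \<Psi> (j + 1) (j + 1) (?y k)) + (\<Sum>k=d..e. \<Sum>j=d+1..k. \<Psi> (j + 1) d j)"
    by (simp only: sum.distrib) (subst sum.swap, rule refl)
  also have "(\<Sum>k=d..e. \<Sum>j=d+1..k. \<Psi> (j + 1) d j) = (\<Sum>b=d+1..e. (e + 1 - b) * \<Psi> (b + 1) d b)"
    unfolding sum_weighted_eq_sum_partial_sums using assms by (simp add: sum.atLeast_Suc_atMost)
  also have "(\<Sum>j=0..d. \<Sum>k=d..e. \<Psi> (j + 1) (j + 1) (?y k)) =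
      (\<Sum>j=0..d. \<Sum>y=d+2..e+2. \<Psi> (j + 1) (j + 1) y)"
  proof (rule sum.cong[OF refl])
    fix j
    let ?g = "\<Psi> (j + 1) (j + 1)"
    have "(\<Sum>k=d..e. ?g (?y k)) = ?g (e + 2) + (\<Sum>k=d+1..e. ?g (?y k))"
      using assms by (simp add: sum.atLeast_Suc_atMost)
    also have "(\<Sum>k=d+1..e. ?g (?y k)) = (\<Sum>k=d+1..e. ?g (k + 1))" by (rule sum.cong) auto
    also have "\<dots> = (\<Sum>y=d+2..e+1. ?g y)"
      using sum.shift_bounds_cl_Suc_ivl[of ?g "d + 1" e] by simp
    finally show "(\<Sum>k=d..e. ?g (?y k)) = (\<Sum>y=d+2..e+2. ?g y)" using assms by simp
  qed
  also have "\<dots> = fertile (\<lambda>w y. \<Psi> w w y) d e"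
    unfolding fertile_def
    using sum.shift_bounds_cl_Suc_ivl[of "\<lambda>w. \<Sum>y=d+2..e+2. \<Psi> w w y" 0 d] by simp
  finally show ?thesis .
qed

text \<open>
  Barren children, with $f = e + 1$, contribute only on the last level, since the range $f \le k \le e$
  of the next step is empty for them. On all earlier levels one may therefore sum over fertile nodes
  alone, all of which satisfy $f = d$.
\<close>

lemma grow_4312_iterated:
  assumes "d \<le> e"
  shows "(grow_4312 ^^ Suc n) (\<lambda>f. \<Phi>) d d e =
    fertile ((grow_1234 ^^ n) \<Phi>) d e + barren ((grow_1234 ^^ n) \<Phi>) d e"
  using assms
proof (induction n arbitrary: d e)
  case 0
  then show ?case by (simp add: grow_4312_diagonal barren_def)
next
  case (Suc n)
  let ?X = "(grow_4312 ^^ Suc n) (\<lambda>f. \<Phi>)" and ?\<Theta> = "(grow_1234 ^^ n) \<Phi>"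
  have leaf: "?X (b + 1) d b = 0" for b
    by (simp add: grow_4312_def)
  have "(grow_4312 ^^ Suc (Suc n)) (\<lambda>f. \<Phi>) d d e = grow_4312 ?X d d e" by simp
  also have "\<dots> = fertile (\<lambda>w y. ?X w w y) d e"
    unfolding grow_4312_diagonal[OF Suc.prems] leaf by simp
  also have "\<dots> = fertile (\<lambda>w y. fertile ?\<Theta> w y + barren ?\<Theta> w y) d e"
    unfolding fertile_def[of "\<lambda>w y. ?X w w y"] fertile_def[of "\<lambda>w y. fertile ?\<Theta> w y + barren ?\<Theta> w y"]
    by (intro sum.cong refl Suc.IH) auto
  also have "\<dots> = fertile (grow_1234 ?\<Theta>) d e + barren (grow_1234 ?\<Theta>) d e"
    by (rule fertile_barren_intertwine[OF Suc.prems])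
  finally show ?case by simp
qed

text \<open>
  The root has a single child in both trees, with labels $(1,2)$; so \<open>fertile\<close> and \<open>grow_1234\<close> agree
  there and \<open>barren\<close> vanishes.
\<close>

lemma grow_trees_agree:
  "(grow_4312 ^^ n) (\<lambda>f. \<Phi>) 0 0 0 = (grow_1234 ^^ n) \<Phi> 0 0"
proof (cases n)
  case (Suc n')
  have "fertile \<Theta> 0 0 + barren \<Theta> 0 0 = grow_1234 \<Theta> 0 0" for \<Theta>
    by (simp add: fertile_def barren_def grow_1234_def)
  then show ?thesis unfolding Suc using grow_4312_iterated[of 0 0 n' \<Phi>] by simp
qed simp

lemma grow_high_iterated:
  assumes "a \<le> b"
  shows "(grow_high ^^ n) \<Phi> a b = (grow_1234 ^^ n) \<Phi> a b"
  using assms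
proof (induction n arbitrary: a b)
  case (Suc n)
  have "(grow_high ^^ Suc n) \<Phi> a b = grow_1234 ((grow_high ^^ n) \<Phi>) a b"
    using grow_high_eq_grow_1234[OF Suc.prems] by simp
  also have "\<dots> = grow_1234 ((grow_1234 ^^ n) \<Phi>) a b"
    unfolding grow_1234_def[of "(grow_high ^^ n) \<Phi>"] grow_1234_def[of "(grow_1234 ^^ n) \<Phi>"]
    by (intro sum.cong refl Suc.IH) auto
  finally show ?case by simp
qed simp

section \<open>Equidistribution of the labels\<close>

lemma alternating_avoiding_0: "alternating_avoiding 0 (c # s) = {[]}"
  by (auto simp: alternating_avoiding_def)

lemma labels_Nil: "first [] = 0" "low_label (c # s) [] = 0" "high_label (c # s) [] = 0"
  by (simp_all add: first_def low_label_def high_label_def)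

lemma sum_labels_4312:
  "(\<Sum>p\<in>alternating_avoiding (2 * n) [4, 3, 1, 2].
     \<Psi> (first p) (low_label [1, 2] p) (low_label [3, 1, 2] p)) = (grow_4312 ^^ n) \<Psi> 0 0 0"
proof (induction n arbitrary: \<Psi>)
  case 0
  show ?case by (simp add: alternating_avoiding_0 labels_Nil)
next
  case (Suc n)
  show ?case
    using sum_step_4312[of \<Psi> "2 * n"] Suc[of "grow_4312 \<Psi>"] by (simp add: funpow_swap1)
qed

lemma sum_labels_1234:
  "(\<Sum>p\<in>alternating_avoiding (2 * n) [1, 2, 3, 4].
     \<Phi> (high_label [3, 4] p) (high_label [2, 3, 4] p)) = (grow_high ^^ n) \<Phi> 0 0"
proof (induction n arbitrary: \<Phi>)
  case 0
  show ?case by (simp add: alternating_avoiding_0 labels_Nil)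
next
  case (Suc n)
  show ?case
    using sum_step_1234[of "2 * n" \<Phi>] Suc[of "grow_high \<Phi>"] by (simp add: funpow_swap1)
qed

theorem labels_equidistributed:
  fixes \<Phi> :: "nat \<Rightarrow> nat \<Rightarrow> nat"
  shows "(\<Sum>p\<in>alternating_avoiding (2 * n) [4, 3, 1, 2]. \<Phi> (low_label [1, 2] p) (low_label [3, 1, 2] p)) =
   (\<Sum>p\<in>alternating_avoiding (2 * n) [1, 2, 3, 4]. \<Phi> (high_label [3, 4] p) (high_label [2, 3, 4] p))"
  using sum_labels_4312[of "\<lambda>f. \<Phi>" n] sum_labels_1234[of \<Phi> n]
    grow_trees_agree[of n \<Phi>] grow_high_iterated[of 0 0 n \<Phi>] by simp

theorem theorem3p2:
  fixes n :: nat
  assumes "n \<ge> 1"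
  shows "card (alternating_avoiding (2 * n) [4, 3, 1, 2]) =
         card (alternating_avoiding (2 * n) [1, 2, 3, 4])"
  using labels_equidistributed[of "\<lambda>_ _. 1" n] by (simp only: card_eq_sum)

end
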